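(* Every digraph $D$ on $n$ vertices has a quasi-kernel $Q$ such that $$|N_D^+[Q]|\ge \sqrt n.$$
   Context: All digraphs are finite and loopless (pairs of opposite arcs are allowed). A set of vertices is independent if there is no arc between any two of its vertices. A quasi-kernel of a digraph $D$ is an independent set $Q\subseteq V(D)$ such that every vertex of $D$ is reachable from some vertex of $Q$ by a directed path of length at most $2$ (length $0$ allowed). For $X\subseteq V(D)$, the closed out-neighborhood is $N_D^+[X]=X\cup\{u\in V(D)\setminus X : xu\in A(D)\text{ for some }x\in X\}$, where $A(D)$ is the arc set of $D$. *)

theory Defs
  imports Complex_Main "Graph_Theory.Digraph" "Graph_Theory.Arc_Walk"
begin

definition independent_set :: "('a,'b) pre_digraph \<Rightarrow> 'a set \<Rightarrow> bool" where
  "independent_set D Q \<longleftrightarrow> Q \<subseteq> verts D \<and> (\<forall>u\<in>Q. \<forall>v\<in>Q. \<not> u \<rightarrow>\<^bsub>D\<^esub> v)"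

(* A path is given by its list of arcs, so its length is the length of that list. *)
definition quasi_kernel :: "('a,'b) pre_digraph \<Rightarrow> 'a set \<Rightarrow> bool" where
  "quasi_kernel D Q \<longleftrightarrow> independent_set D Q \<and>
     (\<forall>v\<in>verts D. \<exists>q\<in>Q. \<exists>p. pre_digraph.apath D q p v \<and> length p \<le> 2)"

definition closed_out_nbhd :: "('a,'b) pre_digraph \<Rightarrow> 'a set \<Rightarrow> 'a set" where
  "closed_out_nbhd D X = X \<union> {u \<in> verts D - X. \<exists>x\<in>X. x \<rightarrow>\<^bsub>D\<^esub> u}"

end

theory Submission
  imports Defs
begin

text \<open>
  Let \<open>v\<close> be a vertex whose closed out-neighborhood \<open>K\<close> is as small as possible, and let \<open>Q'\<close> be a
  quasi-kernel of \<open>D - K\<close>. As in the theorem of Chvatal and Lovasz, either \<open>Q'\<close> (if it has an arc to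
  \<open>v\<close>) or \<open>Q' \<union> {v}\<close> (if it has none) is a quasi-kernel of \<open>D\<close>. In both cases its closed
  out-neighborhood contains \<open>v\<close> and that of \<open>Q'\<close> in \<open>D - K\<close>, so by induction it has at least
  \<open>1 + sqrt (n - |K|)\<close> vertices, which suffices if \<open>|K| \<le> sqrt n\<close>. If \<open>|K| > sqrt n\<close>, already a
  single vertex of the quasi-kernel has a large enough closed out-neighborhood, by the choice of \<open>v\<close>.
\<close>

text \<open>Since \<open>sqrt n\<close> is at least 1, (sqrt n - 1)^2 = n - 2 sqrt n + 1 \<le> n -
  sqrt n.\<close>

lemma sqrt_le_one_plus_sqrt_diff:
  fixes n k :: real
  assumes "1 \<le> n" "k \<le> sqrt n"
  shows "sqrt n \<le> 1 + sqrt (n - k)"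
proof -
  have "1 \<le> sqrt n" "(sqrt n)\<^sup>2 = n" using assms(1) by auto
  then have "(sqrt n - 1)\<^sup>2 \<le> n - k"
    using assms(2) unfolding power2_diff one_power2 by linarith
  from real_le_rsqrt[OF this] show ?thesis by simp
qed

text \<open>Fixing \<open>R\<close> and varying only \<open>V\<close> lets a smaller set stand for
  an induced subdigraph. As \<open>R\<close> may leave \<open>V\<close>, intersecting with
  \<open>V\<close> keeps the middle vertex of a two-step path inside.\<close>

lemma relation_quasi_kernel:
  fixes R :: "'a rel"
  assumes "finite V" "irrefl R"
  shows "\<exists>Q \<subseteq> V. Q \<inter> R `` Q = {} \<and>
    V \<subseteq> V \<inter> (Q \<union> R `` Q) \<union> R `` (V \<inter> (Q \<union> R `` Q)) \<and>
    sqrt (real (card V)) \<le> real (card (V \<inter> (Q \<union> R `` Q)))"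
  using assms(1)
proof (induction V rule: finite_psubset_induct)
  case (psubset V)
  show ?case
  proof (cases "V = {}")
    case True
    then show ?thesis by simp
  next
    case False
    let ?N = "\<lambda>U X. U \<inter> (X \<union> R `` X)"
    define k where "k v = card (?N V {v})" for v
    obtain v where v: "v \<in> V" and min: "\<And>u. u \<in> V \<Longrightarrow> k v \<le> k u"
      using ex_min_if_finite[of "k ` V"] psubset.hyps False
      by (metis (no_types, lifting) finite_imageI image_iff image_is_empty not_less imageI)
    define V' where "V' = V - ?N V {v}"
    have "V' \<subset> V" using v by (auto simp: V'_def)
    from psubset.IH[OF this] obtain Q' where Q': "Q' \<subseteq> V'" "Q' \<inter> R `` Q' = {}"
      "V' \<subseteq> ?N V' Q' \<union> R `` ?N V' Q'" "sqrt (card V') \<le> card (?N V' Q')"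
      by blast
    define Q where "Q = (if v \<in> R `` Q' then Q' else insert v Q')"
    have vv: "(v, v) \<notin> R" using assms(2) by (auto simp: irrefl_def)
    have Q: "Q \<subseteq> V" using Q'(1) v by (auto simp: Q_def V'_def)
    \<comment> \<open>Arcs from \<open>v\<close> to \<open>Q'\<close> are impossible because
      \<open>V'\<close> omits the out-neighbors of \<open>v\<close>; arcs from \<open>Q'\<close> to
      \<open>v\<close> are excluded by the case split in \<open>Q\<close>.\<close>
    have indep: "Q \<inter> R `` Q = {}"
      using Q'(1,2) vv by (auto simp: Q_def V'_def)
    \<comment> \<open>This one inclusion yields both domination and the count: \<open>v\<close> is
      within one step of \<open>Q\<close>, so the removed vertices are within two.\<close>
    have mono: "insert v (?N V' Q') \<subseteq> ?N V Q"
      using v by (auto simp: Q_def V'_def)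
    have dom: "V \<subseteq> ?N V Q \<union> R `` ?N V Q"
    proof
      fix x assume x: "x \<in> V"
      show "x \<in> ?N V Q \<union> R `` ?N V Q"
      proof (cases "x \<in> V'")
        case True
        then show ?thesis using Q'(3) mono by blast
      next
        case False
        then have "x = v \<or> (v, x) \<in> R" using x by (auto simp: V'_def)
        then show ?thesis using mono by blast
      qed
    qed
    have fin: "finite (?N V Q)" using psubset.hyps by simp
    have "v \<notin> ?N V' Q'" using v by (auto simp: V'_def)
    then have "1 + card (?N V' Q') \<le> card (?N V Q)"
      using card_mono[OF fin mono] finite_subset[OF _ fin, of "?N V' Q'"] mono by auto
    then have step: "1 + sqrt (card V') \<le> card (?N V Q)" using Q'(4) by linarith
    have cardV': "real (card V') = real (card V) - real (k v)"
      using psubset.hyps card_mono[of V "?N V {v}"]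
      by (simp add: V'_def k_def card_Diff_subset of_nat_diff)
    have "sqrt (card V) \<le> card (?N V Q)"
    proof (cases "k v \<le> sqrt (card V)")
      case True
      have "1 \<le> real (card V)"
        using psubset.hyps \<open>V \<noteq> {}\<close> by (simp add: Suc_le_eq card_gt_0_iff)
      from sqrt_le_one_plus_sqrt_diff[OF this True] show ?thesis
        using step cardV' by simp
    next
      case False
      \<comment> \<open>\<open>Q'\<close> may be empty, but then \<open>v\<close> itself is in
        \<open>Q\<close>.\<close>
      obtain q where q: "q \<in> Q" unfolding Q_def by (cases "v \<in> R `` Q'") auto
      have "k v \<le> k q" using min q Q by blast
      also have "\<dots> \<le> card (?N V Q)"
        unfolding k_def using q by (intro card_mono[OF fin]) auto
      finally show ?thesis using False by linarith
    qed
    then show ?thesis using Q indep dom by blast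
  qed
qed

lemma (in loopfree_digraph) apath_length_le_1:
  assumes "u \<rightarrow>\<^bsub>G\<^esub> v"
  shows "\<exists>p. apath u p v \<and> length p \<le> 1"
proof -
  obtain e where e: "e \<in> arcs G" "tail G e = u" "head G e = v"
    using assms by (auto simp: arcs_ends_def arc_to_ends_def)
  then have "apath u [e] v"
    using no_loops by (auto simp: apath_def awalk_def)
  then show ?thesis by force
qed

lemma (in loopfree_digraph) apath_length_le_2:
  assumes "u \<rightarrow>\<^bsub>G\<^esub> v" "v \<rightarrow>\<^bsub>G\<^esub> w" "u \<noteq> w"
  shows "\<exists>p. apath u p w \<and> length p \<le> 2"
proof -
  obtain e f where e: "e \<in> arcs G" "tail G e = u" "head G e = v"
    and f: "f \<in> arcs G" "tail G f = v" "head G f = w"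
    using assms by (auto simp: arcs_ends_def arc_to_ends_def)
  then have "apath u [e, f] w"
    using no_loops[OF e(1)] no_loops[OF f(1)] assms(3) by (auto simp: apath_def awalk_def)
  then show ?thesis by force
qed

lemma (in digraph) quasi_kernelI:
  fixes Q
  defines "N \<equiv> verts G \<inter> (Q \<union> arcs_ends G `` Q)"
  assumes "Q \<subseteq> verts G" "Q \<inter> arcs_ends G `` Q = {}" "verts G \<subseteq> N \<union> arcs_ends G `` N"
  shows "quasi_kernel G Q"
  unfolding quasi_kernel_def independent_set_def
proof (intro conjI ballI)
  fix v assume v: "v \<in> verts G"
  consider "v \<in> Q" | q where "q \<in> Q" "q \<rightarrow>\<^bsub>G\<^esub> v"
    \<comment> \<open>Here \<open>v \<notin> Q\<close> forces \<open>q \<noteq> v\<close>, so a pair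
      of opposite arcs cannot turn the two-arc walk into a closed one, which is no
      \<open>apath\<close>.\<close>
    | q w where "q \<in> Q" "q \<rightarrow>\<^bsub>G\<^esub> w" "w \<rightarrow>\<^bsub>G\<^esub> v" "v \<notin> Q"
    using v assms(4) unfolding N_def by blast
  then show "\<exists>q\<in>Q. \<exists>p. apath q p v \<and> length p \<le> 2"
  proof cases
    case 1
    have "apath v [] v" using v by (simp add: apath_def awalk_def)
    with 1 show ?thesis by force
  next
    case 2
    then show ?thesis using apath_length_le_1 by fastforce
  next
    case 3
    then show ?thesis using apath_length_le_2 by metis
  qed
qed (use assms in auto)

theorem theorem1p4:
  fixes D :: "('a,'b) pre_digraph" and n :: nat
  assumes "digraph D" and "card (verts D) = n"
  shows "\<exists>Q. quasi_kernel D Q \<and> real (card (closed_out_nbhd D Q)) \<ge> sqrt (real n)"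
proof -
  interpret digraph D by fact
  have "irrefl (arcs_ends D)"
    using no_loops by (auto simp: irrefl_def arcs_ends_def arc_to_ends_def)
  from relation_quasi_kernel[OF finite_verts this] obtain Q where
    Q: "Q \<subseteq> verts D" "Q \<inter> arcs_ends D `` Q = {}"
      "verts D \<subseteq> verts D \<inter> (Q \<union> arcs_ends D `` Q) \<union>
        arcs_ends D `` (verts D \<inter> (Q \<union> arcs_ends D `` Q))"
    and card: "sqrt (card (verts D)) \<le> card (verts D \<inter> (Q \<union> arcs_ends D `` Q))"
    by blast
  have "closed_out_nbhd D Q = verts D \<inter> (Q \<union> arcs_ends D `` Q)"
    using Q(1) by (auto simp: closed_out_nbhd_def)
  then show ?thesis using quasi_kernelI[OF Q] card assms(2) by auto
qed

end
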